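(* Let $G=(V,E)$ be a finite undirected graph with vertex set $V=\{1,\dots,N\}$, with self-loops (at least one) and without multiple edges. Let $G^o=(V,E^o)$ be the subgraph of $G$ whose edge set $E^o\subset E$ consists of all edges of $E$ that are not self-loops, let $d(G^o)$ be the maximum vertex degree of $G^o$, and let $\hat G$ be the lifted graph of $G$. Then $$\sigma(\mathcal L(G))\subseteq \sigma(\mathcal L(\hat G))\cap[0,\,2d(G^o)+1].$$ Particularly, if $G$ is pseudo-connected, then $$\sigma(\mathcal L(G))\subseteq \sigma_+(\mathcal L(\hat G))\cap[0,\,2d(G^o)+1].$$
   Context: All graphs are finite and undirected, without multiple edges (so each vertex carries at most one self-loop); an edge between $i$ and $j$ is written $(i,j)$ and identified with $(j,i)$, and a self-loop at $i$ is the edge $(i,i)$. Let $\mathbf e_i$ denote the $i$-th standard basis (column) vector. Laplacian: for a graph $G=(V,E)$ with $V=\{1,\dots,N\}$, let $G^o$ be $G$ with all self-loops removed. Then $$\mathcal L(G^o)=\sum_{(i,j)\in E,\ i\ne j}(\mathbf e_i-\mathbf e_j)(\mathbf e_i-\mathbf e_j)^T,\qquad \mathcal L(G)=\mathcal L(G^o)+\sum_{(i,i)\in E}\mathbf e_i\mathbf e_i^T,$$ where each undirected edge is counted once in the sums. For a graph without self-loops this is the usual graph Laplacian (degree matrix minus adjacency matrix). Lifted graph: given $G=(V,E)$ with $N$ vertices and at least one self-loop, its lifted graph $\hat G=(\hat V,\hat E)$ is the graph without self-loops on the $2N+1$ vertices $\{1,\dots,2N+1\}$ (each vertex $i\in\{1,\dots,N\}$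 of $G$ gives vertices $i$ and $i+N+1$ of $\hat G$, and $N+1$ is a "middle vertex") whose edges are exactly the following: for each $(i,j)\in E$ with $i\neq j$, the edges $(i,j)$ and $(i+N+1,j+N+1)$; for each self-loop $(i,i)\in E$, the edges $(i,N+1)$ and $(N+1,i+N+1)$. Pseudo-connected: an undirected graph without multiple edges is pseudo-connected if every vertex is connected by an edge to itself and/or to another vertex, and every connected component of the graph has at least one vertex with a self-loop. (Self-loops do not affect connectedness.) Notation: $\sigma(A)$ is the set of eigenvalues of a square matrix $A$; for a real symmetric matrix $S$, $\sigma_+(S)$ is the set of its positive eigenvalues. *)

theory Defs
  imports "Jordan_Normal_Form.Spectral_Radius"
begin

(* The graph has vertices 1, ..., nverts G. The undirected edge (i,j) is the set {i,j}, so that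
   (i,j) and (j,i) coincide, multiple edges cannot occur, and the self-loop (i,i) is {i,i} = {i}. *)
record graph =
  nverts :: nat
  edges :: "nat set set"

definition verts :: "graph \<Rightarrow> nat set" where
  "verts G = {1..nverts G}"

definition well_formed :: "graph \<Rightarrow> bool" where
  "well_formed G \<longleftrightarrow> edges G \<subseteq> {{i, j} | i j. i \<in> verts G \<and> j \<in> verts G}"

definition has_loop :: "graph \<Rightarrow> nat \<Rightarrow> bool" where
  "has_loop G i \<longleftrightarrow> {i, i} \<in> edges G"

definition del_loops :: "graph \<Rightarrow> graph" where
  "del_loops G = G\<lparr>edges := {e \<in> edges G. \<not> (\<exists>i. e = {i, i})}\<rparr>"

(* Number of incident edges; only used for graphs without self-loops. *)
definition vertex_degree :: "graph \<Rightarrow> nat \<Rightarrow> nat" where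
  "vertex_degree G i = card {e \<in> edges G. i \<in> e}"

definition max_degree :: "graph \<Rightarrow> nat" where
  "max_degree G = Max (vertex_degree G ` verts G)"

(* Vectors and matrices are indexed from 0, vertices from 1. *)
definition basis_vec :: "nat \<Rightarrow> nat \<Rightarrow> real vec" where
  "basis_vec n i = unit_vec n (i - 1)"

(* The matrix v v^T of a column vector v of dimension n. *)
definition rank_one :: "nat \<Rightarrow> real vec \<Rightarrow> real mat" where
  "rank_one n v = mat_of_cols n [v] * transpose_mat (mat_of_cols n [v])"

(* Each undirected non-loop edge is counted once, through its representation with i < j. *)
definition laplacian_no_loops :: "graph \<Rightarrow> real mat" where
  "laplacian_no_loops G =
     finsum (module_mat TYPE(real) (nverts G) (nverts G))
       (\<lambda>(i, j). rank_one (nverts G) (basis_vec (nverts G) i - basis_vec (nverts G) j))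
       {(i, j). i \<in> verts G \<and> j \<in> verts G \<and> i < j \<and> {i, j} \<in> edges G}"

definition laplacian :: "graph \<Rightarrow> real mat" where
  "laplacian G = laplacian_no_loops (del_loops G) +
     finsum (module_mat TYPE(real) (nverts G) (nverts G))
       (\<lambda>i. rank_one (nverts G) (basis_vec (nverts G) i))
       {i \<in> verts G. has_loop G i}"

definition lifted_graph :: "graph \<Rightarrow> graph" where
  "lifted_graph G = (let N = nverts G in
     \<lparr>nverts = 2 * N + 1,
      edges = (\<Union>{{{i, j}, {i + N + 1, j + N + 1}} | i j. i \<noteq> j \<and> {i, j} \<in> edges G})
            \<union> (\<Union>{{{i, N + 1}, {N + 1, i + N + 1}} | i. has_loop G i})\<rparr>)"

definition component :: "graph \<Rightarrow> nat \<Rightarrow> nat set" where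
  "component G i = {j \<in> verts G. (i, j) \<in> {(k, l). {k, l} \<in> edges G}\<^sup>*}"

definition components :: "graph \<Rightarrow> nat set set" where
  "components G = component G ` verts G"

definition pseudo_connected :: "graph \<Rightarrow> bool" where
  "pseudo_connected G \<longleftrightarrow>
     (\<forall>i \<in> verts G. \<exists>j \<in> verts G. {i, j} \<in> edges G) \<and>
     (\<forall>C \<in> components G. \<exists>i \<in> C. has_loop G i)"

(* All complex eigenvalues, so that statements about eigenvalues being real are not built in. *)
definition eigvals :: "real mat \<Rightarrow> complex set" where
  "eigvals A = spectrum (map_mat complex_of_real A)"

definition pos_eigvals :: "real mat \<Rightarrow> complex set" where
  "pos_eigvals S = eigvals S \<inter> complex_of_real ` {0<..}"

lemma well_formed_lifted_graph:
  assumes "well_formed G"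
  shows "well_formed (lifted_graph G)"
proof -
  have v: "i \<in> verts G \<and> j \<in> verts G" if "{i, j} \<in> edges G" for i j
    using assms that unfolding well_formed_def by (force simp: doubleton_eq_iff)
  show ?thesis
    unfolding well_formed_def
  proof
    fix e assume "e \<in> edges (lifted_graph G)"
    then consider i j where "{i, j} \<in> edges G"
        "e = {i, j} \<or> e = {i + nverts G + 1, j + nverts G + 1}"
      | i where "{i, i} \<in> edges G"
        "e = {i, nverts G + 1} \<or> e = {nverts G + 1, i + nverts G + 1}"
      by (auto simp: lifted_graph_def Let_def has_loop_def)
    then show "e \<in> {{i, j} | i j. i \<in> verts (lifted_graph G) \<and> j \<in> verts (lifted_graph G)}"
    proof cases
      case 1
      with v[OF 1(1)] show ?thesis
        by (fastforce simp: verts_def lifted_graph_def Let_def)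
    next
      case 2
      with v[OF 2(1)] show ?thesis
        by (fastforce simp: verts_def lifted_graph_def Let_def)
    qed
  qed
qed

end

(* If x is an eigenvector of L(G), then (x, 0, -x) is one of the Laplacian of the lifted graph for the
   same eigenvalue: a self-loop contributes x_i = x_i - 0 through its edge to the middle vertex, and
   the contributions at the middle vertex cancel. The eigenvalue is the Rayleigh quotient of x, whose
   numerator is the sum of |x_i - x_j|^2 over the edges plus that of |x_i|^2 over the self-loops; the
   bound 2 d + 1 comes from |x_i - x_j|^2 <= 2 |x_i|^2 + 2 |x_j|^2. If the numerator vanishes, x is
   constant on components and zero at self-loops, so x = 0 when G is pseudo-connected. *)
theory Submission
  imports Defs
begin

section \<open>Entries of matrix sums and of rank-one matrices\<close>

lemma finsum_mat_closed:
  fixes f :: "'a \<Rightarrow> 'b :: comm_ring_1 mat"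
  assumes "\<And>s. s \<in> S \<Longrightarrow> f s \<in> carrier_mat n m"
  shows "finsum (module_mat TYPE('b) n m) f S \<in> carrier_mat n m"
proof -
  interpret abelian_group "module_mat TYPE('b) n m" by (rule abelian_group_mat)
  show ?thesis using finsum_closed[of f S] assms by (auto simp: module_mat_simps Pi_iff)
qed

text \<open>Turns the abstract sum in the additive group of matrices, as used in
  \<open>laplacian\<close>, into an ordinary sum of entries. By induction: adding one summand is
  matrix addition, which is entrywise once the remaining sum is known to have the right
  dimensions.\<close>

lemma index_finsum_mat:
  fixes f :: "'a \<Rightarrow> 'b :: comm_ring_1 mat"
  assumes "finite S" and "\<And>s. s \<in> S \<Longrightarrow> f s \<in> carrier_mat n m" and "i < n" and "j < m"
  shows "finsum (module_mat TYPE('b) n m) f S $$ (i, j) = (\<Sum>s\<in>S. f s $$ (i, j))"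
proof -
  interpret abelian_group "module_mat TYPE('b) n m" by (rule abelian_group_mat)
  show ?thesis
    using assms(1,2)
  proof (induction S rule: finite_induct)
    case empty
    then show ?case using assms(3,4) finsum_empty[of f] by (simp add: module_mat_simps)
  next
    case (insert s S)
    have "finsum (module_mat TYPE('b) n m) f (insert s S) =
        f s + finsum (module_mat TYPE('b) n m) f S"
      using finsum_insert[of S s f] insert by (auto simp: module_mat_simps Pi_iff)
    moreover have "finsum (module_mat TYPE('b) n m) f S \<in> carrier_mat n m"
      using insert by (intro finsum_mat_closed) auto
    ultimately show ?case using insert assms(3,4) by auto
  qed
qed

lemma index_rank_one:
  assumes "v \<in> carrier_vec n" "a < n" "b < n"
  shows "rank_one n v $$ (a, b) = v $ a * v $ b"
  using assms by (simp add: rank_one_def scalar_prod_def mat_of_cols_index)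

lemma rank_one_carrier [simp]: "rank_one n v \<in> carrier_mat n n"
  by (rule carrier_matI) (simp_all add: rank_one_def)

lemma basis_vec_carrier [simp]: "basis_vec n i \<in> carrier_vec n"
  by (simp add: basis_vec_def)

lemma finite_verts [simp]: "finite (verts G)"
  by (simp add: verts_def)

section \<open>The Laplacian as an operator on functions on the vertices\<close>

definition nbrs :: "graph \<Rightarrow> nat \<Rightarrow> nat set" where
  "nbrs G a = {j \<in> verts G. j \<noteq> a \<and> {a, j} \<in> edges G}"

lemma finite_nbrs [simp]: "finite (nbrs G a)"
  by (simp add: nbrs_def)

(* The Laplacian acting on functions on the vertices, which avoids the index shift of vectors. *)
definition lap :: "graph \<Rightarrow> (nat \<Rightarrow> complex) \<Rightarrow> nat \<Rightarrow> complex" where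
  "lap G f a = (\<Sum>j\<in>nbrs G a. f a - f j) + (if has_loop G a then f a else 0)"

text \<open>The index set in \<open>laplacian_no_loops\<close>: every non-loop edge in its
  increasing orientation.\<close>

definition edge_pairs :: "graph \<Rightarrow> (nat \<times> nat) set" where
  "edge_pairs G = {(i, j). i \<in> verts G \<and> j \<in> verts G \<and> i < j \<and> {i, j} \<in> edges G}"

lemma finite_edge_pairs [simp]: "finite (edge_pairs G)"
  by (rule finite_subset[of _ "verts G \<times> verts G"]) (auto simp: edge_pairs_def)

text \<open>A pair with \<open>i < j\<close> is never a self-loop, so deleting the loops removes no
  pair.\<close>

lemma edge_pairs_del_loops: "edge_pairs (del_loops G) = edge_pairs G"
  by (auto simp: edge_pairs_def del_loops_def verts_def doubleton_eq_iff)

lemma nverts_del_loops [simp]: "nverts (del_loops G) = nverts G"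
  by (simp add: del_loops_def)

lemma laplacian_carrier: "laplacian G \<in> carrier_mat (nverts G) (nverts G)"
  unfolding laplacian_def by (intro add_carrier_mat finsum_mat_closed) simp

lemma dim_laplacian [simp]:
  "dim_row (laplacian G) = nverts G" "dim_col (laplacian G) = nverts G"
  using laplacian_carrier[of G] by auto

text \<open>Here \<open>of_bool (a = i - 1)\<close> is coordinate \<open>a\<close> of the basis
  vector of vertex \<open>i\<close>, and an entry of a rank-one matrix is a product of two
  coordinates.\<close>

lemma index_laplacian:
  assumes "a < nverts G" "b < nverts G"
  shows "laplacian G $$ (a, b) =
    (\<Sum>(i, j)\<in>edge_pairs G. (of_bool (a = i - 1) - of_bool (a = j - 1)) *
        (of_bool (b = i - 1) - of_bool (b = j - 1))) +
    (\<Sum>i\<in>{i \<in> verts G. has_loop G i}. of_bool (a = i - 1) * of_bool (b = i - 1))"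
proof -
  let ?n = "nverts G"
  let ?E = "\<lambda>(i, j). rank_one ?n (basis_vec ?n i - basis_vec ?n j)"
  let ?L = "\<lambda>i. rank_one ?n (basis_vec ?n i)"
  have E: "?E s \<in> carrier_mat ?n ?n" for s by (cases s) simp
  have carr: "finsum (module_mat TYPE(real) ?n ?n) ?L {i \<in> verts G. has_loop G i} \<in> carrier_mat ?n ?n"
    by (intro finsum_mat_closed) simp
  have "laplacian G = finsum (module_mat TYPE(real) ?n ?n) ?E (edge_pairs G) +
      finsum (module_mat TYPE(real) ?n ?n) ?L {i \<in> verts G. has_loop G i}"
    unfolding laplacian_def laplacian_no_loops_def edge_pairs_def[symmetric]
      edge_pairs_del_loops nverts_del_loops ..
  then have "laplacian G $$ (a, b) = (\<Sum>s\<in>edge_pairs G. ?E s $$ (a, b)) +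
      (\<Sum>i\<in>{i \<in> verts G. has_loop G i}. ?L i $$ (a, b))"
    using carr assms E by (simp add: index_finsum_mat del: split_paired_All)
  also have "(\<Sum>s\<in>edge_pairs G. ?E s $$ (a, b)) = (\<Sum>(i, j)\<in>edge_pairs G.
      (of_bool (a = i - 1) - of_bool (a = j - 1)) * (of_bool (b = i - 1) - of_bool (b = j - 1)))"
    using assms
    by (intro sum.cong refl)
      (auto simp: index_rank_one minus_carrier_vec basis_vec_def edge_pairs_def verts_def)
  also have "(\<Sum>i\<in>{i \<in> verts G. has_loop G i}. ?L i $$ (a, b)) =
      (\<Sum>i\<in>{i \<in> verts G. has_loop G i}. of_bool (a = i - 1) * of_bool (b = i - 1))"
    using assms by (intro sum.cong refl) (auto simp: index_rank_one basis_vec_def verts_def)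
  finally show ?thesis .
qed

text \<open>An edge at \<open>a\<close> occurs either as \<open>(a, j)\<close>, with contribution
  \<open>f a - f j\<close>, or as \<open>(j, a)\<close>, with contribution
  \<open>- (f j - f a)\<close>. These agree, so the chosen orientation does not matter.\<close>

lemma sum_edge_pairs:
  fixes f :: "nat \<Rightarrow> complex"
  assumes "a \<in> verts G"
  shows "(\<Sum>(i, j)\<in>edge_pairs G. (of_bool (a = i) - of_bool (a = j)) * (f i - f j)) =
    (\<Sum>j\<in>nbrs G a. f a - f j)"
proof -
  let ?A = "{j \<in> verts G. a < j \<and> {a, j} \<in> edges G}"
  let ?B = "{j \<in> verts G. j < a \<and> {a, j} \<in> edges G}"
  \<comment> \<open>Pairs that avoid \<open>a\<close> have coefficient 0; the others are split by
    whether \<open>a\<close> is the smaller or the larger endpoint.\<close>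
  have "(\<Sum>(i, j)\<in>edge_pairs G. (of_bool (a = i) - of_bool (a = j)) * (f i - f j)) =
      (\<Sum>(i, j)\<in>Pair a ` ?A \<union> (\<lambda>j. (j, a)) ` ?B. (of_bool (a = i) - of_bool (a = j)) * (f i - f j))"
    using assms
    by (intro sum.mono_neutral_right finite_edge_pairs) (auto simp: edge_pairs_def of_bool_def insert_commute image_iff split: if_splits)
  also have "\<dots> = (\<Sum>(i, j)\<in>Pair a ` ?A. (of_bool (a = i) - of_bool (a = j)) * (f i - f j)) +
      (\<Sum>(i, j)\<in>(\<lambda>j. (j, a)) ` ?B. (of_bool (a = i) - of_bool (a = j)) * (f i - f j))"
    by (rule sum.union_disjoint) auto
  also have "\<dots> = (\<Sum>j\<in>?A. f a - f j) + (\<Sum>j\<in>?B. f a - f j)"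
    by (auto simp: sum.reindex inj_on_def intro!: arg_cong2[where f = "(+)"] sum.cong)
  also have "\<dots> = (\<Sum>j\<in>?A \<union> ?B. f a - f j)"
    by (rule sum.union_disjoint[symmetric]) auto
  also have "?A \<union> ?B = nbrs G a" by (auto simp: nbrs_def)
  finally show ?thesis .
qed

lemma laplacian_mult_vec:
  assumes "x \<in> carrier_vec (nverts G)" "a \<in> verts G"
  shows "(map_mat complex_of_real (laplacian G) *\<^sub>v x) $ (a - 1) = lap G (\<lambda>i. x $ (i - 1)) a"
proof -
  let ?n = "nverts G"
  have a: "a - 1 < ?n" "a \<ge> 1" using assms by (auto simp: verts_def)
  have pick: "(\<Sum>b<?n. of_bool (b = i - 1) * x $ b) = x $ (i - 1)" if "i \<in> verts G" for i
    using that by (auto simp: of_bool_def if_distrib[of "\<lambda>c. c * _"] verts_def cong: if_cong)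
  \<comment> \<open>Both vertices must be at least 1: truncated subtraction would otherwise send 0
    and 1 to the same index.\<close>
  have eq: "(a - 1 = i - 1) = (a = i)" if "i \<in> verts G" for i
    using that a by (auto simp: verts_def)
  have "(map_mat complex_of_real (laplacian G) *\<^sub>v x) $ (a - 1) =
      (\<Sum>b<?n. complex_of_real (laplacian G $$ (a - 1, b)) * x $ b)"
    using assms(1) a by (simp add: scalar_prod_def atLeast0LessThan)
  also have "\<dots> = (\<Sum>b<?n. (\<Sum>(i, j)\<in>edge_pairs G.
         (of_bool (a - 1 = i - 1) - of_bool (a - 1 = j - 1)) *
        (of_bool (b = i - 1) * x $ b - of_bool (b = j - 1) * x $ b)) +
      (\<Sum>i\<in>{i \<in> verts G. has_loop G i}. of_bool (a - 1 = i - 1) * (of_bool (b = i - 1) * x $ b)))"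
  proof (intro sum.cong refl)
    fix b assume "b \<in> {..<?n}"
    then have "b < ?n" by simp
    show "complex_of_real (laplacian G $$ (a - 1, b)) * x $ b = (\<Sum>(i, j)\<in>edge_pairs G.
         (of_bool (a - 1 = i - 1) - of_bool (a - 1 = j - 1)) *
        (of_bool (b = i - 1) * x $ b - of_bool (b = j - 1) * x $ b)) +
      (\<Sum>i\<in>{i \<in> verts G. has_loop G i}. of_bool (a - 1 = i - 1) * (of_bool (b = i - 1) * x $ b))"
      unfolding index_laplacian[OF a(1) \<open>b < ?n\<close>] of_real_add of_real_sum distrib_right
        sum_distrib_right
      by (intro arg_cong2[where f = "(+)"] sum.cong refl)
        (auto simp: of_bool_def split: prod.splits)
  qed
  \<comment> \<open>Summing over the columns \<open>b\<close> first lets \<open>pick\<close>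
    evaluate each inner sum to a single coordinate of \<open>x\<close>.\<close>
  also have "\<dots> = (\<Sum>(i, j)\<in>edge_pairs G. (of_bool (a - 1 = i - 1) - of_bool (a - 1 = j - 1)) *
        ((\<Sum>b<?n. of_bool (b = i - 1) * x $ b) - (\<Sum>b<?n. of_bool (b = j - 1) * x $ b))) +
      (\<Sum>i\<in>{i \<in> verts G. has_loop G i}. of_bool (a - 1 = i - 1) * (\<Sum>b<?n. of_bool (b = i - 1) * x $ b))"
    unfolding sum.distrib sum_subtractf[symmetric] sum_distrib_left case_prod_unfold
    by (intro arg_cong2[where f = "(+)"]; rule sum.swap)
  also have "\<dots> = (\<Sum>(i, j)\<in>edge_pairs G. (of_bool (a = i) - of_bool (a = j)) *
        (x $ (i - 1) - x $ (j - 1))) +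
      (\<Sum>i\<in>{i \<in> verts G. has_loop G i}. of_bool (a = i) * x $ (i - 1))"
    by (intro arg_cong2[where f = "(+)"] sum.cong refl)
      (auto simp only: edge_pairs_def mem_Collect_eq prod.case pick eq)
  also have "(\<Sum>i\<in>{i \<in> verts G. has_loop G i}. of_bool (a = i) * x $ (i - 1)) =
      (if has_loop G a then x $ (a - 1) else 0)"
    using assms by (simp add: of_bool_def if_distrib[of "\<lambda>c. c * _"] cong: if_cong)
  also have "(\<Sum>(i, j)\<in>edge_pairs G. (of_bool (a = i) - of_bool (a = j)) *
        (x $ (i - 1) - x $ (j - 1))) = (\<Sum>j\<in>nbrs G a. x $ (a - 1) - x $ (j - 1))"
    using sum_edge_pairs[OF assms(2), of "\<lambda>i. x $ (i - 1)"] .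
  finally show ?thesis by (simp add: lap_def)
qed

text \<open>Bridge from matrices to functions: eigenvectors correspond to eigenfunctions of
  \<open>lap\<close>, so that the spectral arguments can be carried out on vertex functions.\<close>

lemma eigvals_laplacian_iff:
  "k \<in> eigvals (laplacian G) \<longleftrightarrow>
    (\<exists>f. (\<exists>a\<in>verts G. f a \<noteq> 0) \<and> (\<forall>a\<in>verts G. lap G f a = k * f a))"
    (is "_ \<longleftrightarrow> ?R")
proof
  let ?n = "nverts G" and ?A = "map_mat complex_of_real (laplacian G)"
  assume "k \<in> eigvals (laplacian G)"
  then obtain x where x: "x \<in> carrier_vec ?n" "x \<noteq> 0\<^sub>v ?n" "?A *\<^sub>v x = k \<cdot>\<^sub>v x"
    by (auto simp: eigvals_def spectrum_def eigenvalue_def eigenvector_def)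
  obtain i where i: "i < ?n" "x $ i \<noteq> 0"
    using x(1,2) by (metis carrier_vecD eq_vecI index_zero_vec(1,2))
  show ?R
  proof (intro exI conjI ballI)
    show "\<exists>a\<in>verts G. x $ (a - 1) \<noteq> 0"
      using i by (intro bexI[of _ "Suc i"]) (auto simp: verts_def)
    show "lap G (\<lambda>a. x $ (a - 1)) a = k * x $ (a - 1)" if "a \<in> verts G" for a
      using that x laplacian_mult_vec[OF x(1) that] by (auto simp: verts_def)
  qed
next
  let ?n = "nverts G" and ?A = "map_mat complex_of_real (laplacian G)"
  assume ?R
  then obtain f a where f: "a \<in> verts G" "f a \<noteq> 0"
    "\<And>a. a \<in> verts G \<Longrightarrow> lap G f a = k * f a" by blast
  \<comment> \<open>Coordinate \<open>i\<close> of the vector belongs to vertex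
    \<open>Suc i\<close>.\<close>
  define x where "x = vec ?n (\<lambda>i. f (Suc i))"
  have x: "x \<in> carrier_vec ?n" by (simp add: x_def)
  have xf: "x $ (i - 1) = f i" if "i \<in> verts G" for i
    using that by (auto simp: x_def verts_def)
  have "x \<noteq> 0\<^sub>v ?n"
    using xf[OF f(1)] f(1,2) by (auto simp: verts_def)
  moreover have "?A *\<^sub>v x = k \<cdot>\<^sub>v x"
  proof (rule eq_vecI)
    fix i assume "i < dim_vec (k \<cdot>\<^sub>v x)"
    then have i: "i < ?n" "Suc i \<in> verts G" using x by (auto simp: verts_def)
    \<comment> \<open>\<open>lap\<close> evaluates its argument only at vertices of
      \<open>G\<close>, where \<open>x\<close> and \<open>f\<close> agree.\<close>
    have "lap G (\<lambda>i. x $ (i - 1)) (Suc i) = lap G f (Suc i)"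
      using i xf unfolding lap_def
      by (intro arg_cong2[where f = "(+)"] sum.cong) (auto simp: nbrs_def x_def)
    then show "(?A *\<^sub>v x) $ i = (k \<cdot>\<^sub>v x) $ i"
      using laplacian_mult_vec[OF x i(2)] f(3)[OF i(2)] xf[OF i(2)] x i by simp
  qed (use x in auto)
  ultimately show "k \<in> eigvals (laplacian G)"
    using x
    by (auto simp: eigvals_def spectrum_def eigenvalue_def eigenvector_def)
qed

section \<open>The quadratic form of the Laplacian and bounds on its eigenvalues\<close>

lemma well_formed_edge:
  assumes "well_formed G" "{i, j} \<in> edges G"
  shows "i \<in> verts G" "j \<in> verts G"
  using assms unfolding well_formed_def by (force simp: doubleton_eq_iff)+

text \<open>The map sending \<open>j\<close> to \<open>{a, j}\<close> is a bijection from the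
  neighbours of \<open>a\<close> onto the non-loop edges at \<open>a\<close>; well-formedness puts
  the other endpoint among the vertices.\<close>

lemma card_nbrs_le_max_degree:
  assumes "well_formed G" "a \<in> verts G"
  shows "card (nbrs G a) \<le> max_degree (del_loops G)"
proof -
  have "{e \<in> edges (del_loops G). a \<in> e} = (\<lambda>j. {a, j}) ` nbrs G a"
  proof (intro equalityI subsetI)
    fix e assume e: "e \<in> {e \<in> edges (del_loops G). a \<in> e}"
    then obtain i j where ij: "e = {i, j}" "i \<in> verts G" "j \<in> verts G"
      using assms(1) by (auto simp: well_formed_def del_loops_def)
    then show "e \<in> (\<lambda>j. {a, j}) ` nbrs G a"
      using e by (auto simp: nbrs_def del_loops_def insert_commute)
  qed (auto simp: nbrs_def del_loops_def doubleton_eq_iff)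
  moreover have "inj_on (\<lambda>j. {a, j}) (nbrs G a)"
    by (auto simp: inj_on_def doubleton_eq_iff)
  ultimately have "vertex_degree (del_loops G) a = card (nbrs G a)"
    by (simp add: vertex_degree_def card_image)
  moreover have "a \<in> verts (del_loops G)" using assms(2) by (simp add: verts_def)
  ultimately show ?thesis unfolding max_degree_def by (metis Max_ge finite_imageI finite_verts imageI)
qed

text \<open>Adjacency is symmetric, so the double sum runs over a set of ordered pairs that is
  closed under exchange.\<close>

lemma sum_nbrs_swap:
  "(\<Sum>a\<in>verts G. \<Sum>j\<in>nbrs G a. g a j) = (\<Sum>a\<in>verts G. \<Sum>j\<in>nbrs G a. g j a)"
proof -
  have "(\<Sum>a\<in>verts G. \<Sum>j\<in>nbrs G a. g a j) =
      (\<Sum>j\<in>verts G. \<Sum>a\<in>{a \<in> verts G. j \<noteq> a \<and> {a, j} \<in> edges G}. g a j)"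
    unfolding nbrs_def by (rule sum.swap_restrict) auto
  also have "\<dots> = (\<Sum>a\<in>verts G. \<Sum>j\<in>nbrs G a. g j a)"
    by (intro sum.cong) (auto simp: nbrs_def insert_commute)
  finally show ?thesis .
qed

(* Each edge occurs in both orientations in the double sum, hence the division by 2. *)
definition dirichlet :: "graph \<Rightarrow> (nat \<Rightarrow> complex) \<Rightarrow> real" where
  "dirichlet G f = (\<Sum>a\<in>verts G. \<Sum>j\<in>nbrs G a. (cmod (f a - f j))\<^sup>2) / 2 +
     (\<Sum>a\<in>verts G. if has_loop G a then (cmod (f a))\<^sup>2 else 0)"

text \<open>Discrete Green identity: summation by parts expresses the Hermitian form of the
  Laplacian through squared differences along edges.\<close>

lemma sum_cnj_lap:
  "(\<Sum>a\<in>verts G. cnj (f a) * lap G f a) = of_real (dirichlet G f)"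
proof -
  define S where "S = (\<Sum>a\<in>verts G. \<Sum>j\<in>nbrs G a. cnj (f a) * (f a - f j))"
  \<comment> \<open>Symmetrization: adding the copy with \<open>a\<close> and \<open>j\<close>
    exchanged turns each summand into \<open>(f a - f j) * cnj (f a - f j)\<close>.\<close>
  have "2 * S = (\<Sum>a\<in>verts G. \<Sum>j\<in>nbrs G a. cnj (f a) * (f a - f j)) +
      (\<Sum>a\<in>verts G. \<Sum>j\<in>nbrs G a. cnj (f j) * (f j - f a))"
    unfolding S_def sum_nbrs_swap[of "\<lambda>a j. cnj (f j) * (f j - f a)"] by simp
  also have "\<dots> = (\<Sum>a\<in>verts G. \<Sum>j\<in>nbrs G a. of_real ((cmod (f a - f j))\<^sup>2))"
    unfolding sum.distrib[symmetric]
    by (intro sum.cong refl) (simp only: complex_norm_square, simp add: algebra_simps)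
  finally have S: "S = of_real ((\<Sum>a\<in>verts G. \<Sum>j\<in>nbrs G a. (cmod (f a - f j))\<^sup>2) / 2)"
    by (simp add: field_simps)
  have "(\<Sum>a\<in>verts G. cnj (f a) * lap G f a) =
      S + (\<Sum>a\<in>verts G. if has_loop G a then of_real ((cmod (f a))\<^sup>2) else 0)"
    unfolding S_def sum.distrib[symmetric]
    by (intro sum.cong refl)
      (simp add: lap_def distrib_left sum_distrib_left complex_norm_square mult.commute
        del: of_real_power)
  also have "\<dots> = of_real (dirichlet G f)"
    unfolding dirichlet_def S of_real_add of_real_sum if_distrib[of complex_of_real] of_real_0 ..
  finally show ?thesis .
qed

text \<open>In the double sum each vertex appears both as \<open>a\<close> and as \<open>j\<close>,
  with weight 2 each time, so it gets 4 times its degree. Halving leaves at most 2 d, and a possible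
  self-loop adds the final 1.\<close>

lemma dirichlet_le:
  assumes "well_formed G"
  shows "dirichlet G f \<le> (2 * real (max_degree (del_loops G)) + 1) * (\<Sum>a\<in>verts G. (cmod (f a))\<^sup>2)"
proof -
  let ?d = "real (max_degree (del_loops G))" and ?q = "\<lambda>a. (cmod (f a))\<^sup>2"
  have par: "(cmod (f a - f j))\<^sup>2 \<le> 2 * ?q a + 2 * ?q j" for a j
  proof -
    have "(cmod (f a - f j))\<^sup>2 \<le> (cmod (f a) + cmod (f j))\<^sup>2"
      by (simp add: norm_triangle_ineq4 power_mono)
    \<comment> \<open>The difference of the two sides is the square of
      \<open>cmod (f a) - cmod (f j)\<close>.\<close>
    also have "\<dots> \<le> 2 * ?q a + 2 * ?q j"
      using zero_le_power2[of "cmod (f a) - cmod (f j)"] by (simp add: power2_eq_square algebra_simps)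
    finally show ?thesis .
  qed
  have "(\<Sum>a\<in>verts G. \<Sum>j\<in>nbrs G a. (cmod (f a - f j))\<^sup>2) \<le>
      (\<Sum>a\<in>verts G. \<Sum>j\<in>nbrs G a. 2 * ?q a + 2 * ?q j)"
    by (intro sum_mono par)
  also have "\<dots> = (\<Sum>a\<in>verts G. \<Sum>j\<in>nbrs G a. 2 * ?q a) + (\<Sum>a\<in>verts G. \<Sum>j\<in>nbrs G a. 2 * ?q j)"
    by (simp add: sum.distrib)
  also have "\<dots> = 4 * (\<Sum>a\<in>verts G. real (card (nbrs G a)) * ?q a)"
    unfolding sum_nbrs_swap[of "\<lambda>a j. 2 * ?q j"] by (simp add: sum_distrib_left)
  also have "\<dots> \<le> 4 * (\<Sum>a\<in>verts G. ?d * ?q a)"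
    using card_nbrs_le_max_degree[OF assms]
    by (intro mult_left_mono sum_mono mult_right_mono) auto
  also have "\<dots> = 4 * (?d * (\<Sum>a\<in>verts G. ?q a))"
    by (simp only: sum_distrib_left)
  finally have "(\<Sum>a\<in>verts G. \<Sum>j\<in>nbrs G a. (cmod (f a - f j))\<^sup>2) / 2 \<le> 2 * ?d * (\<Sum>a\<in>verts G. ?q a)"
    by simp
  moreover have "(\<Sum>a\<in>verts G. if has_loop G a then ?q a else 0) \<le> (\<Sum>a\<in>verts G. ?q a)"
    by (intro sum_mono) simp
  ultimately show ?thesis by (simp add: dirichlet_def distrib_right)
qed

lemma dirichlet_nonneg: "0 \<le> dirichlet G f"
  unfolding dirichlet_def by (intro add_nonneg_nonneg divide_nonneg_nonneg sum_nonneg) auto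

lemma dirichlet_eq_0_imp:
  assumes "well_formed G" "pseudo_connected G" "dirichlet G f = 0" "a \<in> verts G"
  shows "f a = 0"
proof -
  have nonneg: "0 \<le> (\<Sum>a\<in>verts G. \<Sum>j\<in>nbrs G a. (cmod (f a - f j))\<^sup>2)"
    "0 \<le> (\<Sum>a\<in>verts G. if has_loop G a then (cmod (f a))\<^sup>2 else 0)"
    by (intro sum_nonneg; simp)+
  \<comment> \<open>Two nonnegative parts with sum 0 both vanish, and then so does each of their
    summands.\<close>
  then have z: "(\<Sum>a\<in>verts G. \<Sum>j\<in>nbrs G a. (cmod (f a - f j))\<^sup>2) = 0"
    "(\<Sum>a\<in>verts G. if has_loop G a then (cmod (f a))\<^sup>2 else 0) = 0"
    using assms(3) by (auto simp: dirichlet_def)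
  have const: "f b = f j" if "b \<in> verts G" "j \<in> nbrs G b" for b j
    using z(1) that by (simp add: sum_nonneg_eq_0_iff sum_nonneg)
  have loop: "f b = 0" if "b \<in> verts G" "has_loop G b" for b
    using z(2) that by (auto simp: sum_nonneg_eq_0_iff split: if_splits)
  obtain i where i: "i \<in> verts G" "(a, i) \<in> {(k, l). {k, l} \<in> edges G}\<^sup>*" "has_loop G i"
    using assms(2,4) by (auto simp: pseudo_connected_def components_def component_def)
  from i(2) have "f i = f a"
  proof (induction rule: rtrancl_induct)
    case (step y z)
    then have yz: "{y, z} \<in> edges G" by simp
    \<comment> \<open>A step of the path may be a self-loop, which \<open>nbrs\<close>
      excludes.\<close>
    then have "y = z \<or> z \<in> nbrs G y"
      using well_formed_edge[OF assms(1) yz] by (auto simp: nbrs_def)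
    then show ?case using const step well_formed_edge[OF assms(1) yz] by metis
  qed simp
  then show ?thesis using loop[OF i(1,3)] by simp
qed

text \<open>Pairing the eigenvalue equation with \<open>cnj f\<close> gives
  \<open>dirichlet G f\<close> as \<open>k\<close> times the squared norm of \<open>f\<close>. Hence
  the a priori complex \<open>k\<close> is a quotient of reals, and the bounds on the form carry
  over.\<close>

lemma lap_eigenvalue_bounds:
  assumes "well_formed G" "\<exists>a\<in>verts G. f a \<noteq> 0" "\<forall>a\<in>verts G. lap G f a = k * f a"
  obtains r where "k = complex_of_real r" "0 \<le> r" "r \<le> 2 * real (max_degree (del_loops G)) + 1"
    "pseudo_connected G \<Longrightarrow> 0 < r"
proof -
  let ?q = "\<Sum>a\<in>verts G. (cmod (f a))\<^sup>2"
  have pos: "0 < ?q"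
    using assms(2) by (auto intro: sum_pos2)
  have "of_real (dirichlet G f) = (\<Sum>a\<in>verts G. cnj (f a) * (k * f a))"
    using assms(3) by (simp flip: sum_cnj_lap)
  also have "\<dots> = k * of_real ?q"
    by (simp add: sum_distrib_left complex_norm_square mult_ac del: of_real_power)
  finally have "k = of_real (dirichlet G f / ?q)"
    using pos by (metis less_irrefl nonzero_mult_div_cancel_right of_real_divide of_real_eq_0_iff)
  moreover have "dirichlet G f / ?q \<le> 2 * real (max_degree (del_loops G)) + 1"
    using dirichlet_le[OF assms(1), of f] pos by (simp add: divide_le_eq)
  moreover have "0 < dirichlet G f / ?q" if "pseudo_connected G"
    using dirichlet_eq_0_imp[OF assms(1) that] dirichlet_nonneg[of G f] assms(2) pos
    by (metis divide_pos_pos order_le_imp_less_or_eq)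
  ultimately show thesis
    using that dirichlet_nonneg[of G f] pos by (metis divide_nonneg_pos)
qed

section \<open>Adjacency in the lifted graph\<close>

lemma nverts_lifted [simp]: "nverts (lifted_graph G) = 2 * nverts G + 1"
  by (simp add: lifted_graph_def Let_def)

text \<open>For ordinary edges one order of \<open>u\<close> and \<open>v\<close> suffices, since
  \<open>i\<close> and \<open>j\<close> can be exchanged. For edges at the middle vertex the
  endpoints play different roles, so both orders are listed.\<close>

lemma lifted_edge_iff:
  "{u, v} \<in> edges (lifted_graph G) \<longleftrightarrow>
    (\<exists>i j. i \<noteq> j \<and> {i, j} \<in> edges G \<and>
      (u = i \<and> v = j \<or> u = i + nverts G + 1 \<and> v = j + nverts G + 1)) \<or>
    (\<exists>i. has_loop G i \<and> (u = nverts G + 1 \<and> (v = i \<or> v = i + nverts G + 1) \<or>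
      v = nverts G + 1 \<and> (u = i \<or> u = i + nverts G + 1)))"
  (is "?l \<longleftrightarrow> ?r1 \<or> ?r2")
proof
  assume ?l
  then consider i j where "i \<noteq> j" "{i, j} \<in> edges G"
      "{u, v} = {i, j} \<or> {u, v} = {i + nverts G + 1, j + nverts G + 1}"
    | i where "has_loop G i"
      "{u, v} = {i, nverts G + 1} \<or> {u, v} = {nverts G + 1, i + nverts G + 1}"
    by (auto simp: lifted_graph_def Let_def)
  then show "?r1 \<or> ?r2"
  proof cases
    case 1
    then have "{j, i} \<in> edges G" by (simp add: insert_commute)
    from 1(3) consider "u = i \<and> v = j \<or> u = i + nverts G + 1 \<and> v = j + nverts G + 1"
      | "u = j \<and> v = i \<or> u = j + nverts G + 1 \<and> v = i + nverts G + 1"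
      unfolding doubleton_eq_iff by blast
    then have ?r1
    proof cases
      case 1
      with \<open>i \<noteq> j\<close> \<open>{i, j} \<in> edges G\<close> show ?thesis by (intro exI[of _ i] exI[of _ j]) simp
    next
      case 2
      with \<open>i \<noteq> j\<close> \<open>{j, i} \<in> edges G\<close> show ?thesis by (intro exI[of _ j] exI[of _ i]) simp
    qed
    then show ?thesis ..
  next
    case 2
    from 2(2) have "u = nverts G + 1 \<and> (v = i \<or> v = i + nverts G + 1) \<or>
      v = nverts G + 1 \<and> (u = i \<or> u = i + nverts G + 1)"
      unfolding doubleton_eq_iff by blast
    with 2(1) have ?r2 by (intro exI[of _ i]) simp
    then show ?thesis ..
  qed
next
  have E: "{i, j} \<in> edges (lifted_graph G)"
    "{i + nverts G + 1, j + nverts G + 1} \<in> edges (lifted_graph G)"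
    if "i \<noteq> j" "{i, j} \<in> edges G" for i j
    unfolding lifted_graph_def Let_def graph.select_convs
    by (rule UnI1, rule UnionI[of "{{i, j}, {i + nverts G + 1, j + nverts G + 1}}"],
      intro CollectI exI conjI, rule refl, rule that, rule that, simp)+
  have L: "{i, nverts G + 1} \<in> edges (lifted_graph G)"
    "{nverts G + 1, i + nverts G + 1} \<in> edges (lifted_graph G)" if "has_loop G i" for i
    unfolding lifted_graph_def Let_def graph.select_convs
    by (rule UnI2, rule UnionI[of "{{i, nverts G + 1}, {nverts G + 1, i + nverts G + 1}}"],
      intro CollectI exI conjI, rule refl, rule that, simp)+
  assume "?r1 \<or> ?r2"
  then show ?l
  proof (elim disjE exE conjE)
    fix i j assume "i \<noteq> j" "{i, j} \<in> edges G" "u = i" "v = j"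
    then show ?l using E(1) by simp
  next
    fix i j assume "i \<noteq> j" "{i, j} \<in> edges G" "u = i + nverts G + 1" "v = j + nverts G + 1"
    then show ?l using E(2)[of i j] by simp
  next
    fix i assume "has_loop G i" "u = nverts G + 1" "v = i"
    then show ?l using L(1)[of i] by (simp add: insert_commute)
  next
    fix i assume "has_loop G i" "u = nverts G + 1" "v = i + nverts G + 1"
    then show ?l using L(2)[of i] by simp
  next
    fix i assume "has_loop G i" "v = nverts G + 1" "u = i"
    then show ?l using L(1)[of i] by simp
  next
    fix i assume "has_loop G i" "v = nverts G + 1" "u = i + nverts G + 1"
    then show ?l using L(2)[of i] by (simp add: insert_commute)
  qed
qed

text \<open>The middle vertex \<open>M\<close> separates the two copies of \<open>G\<close>:
  well-formedness puts the lower one in 1 to \<open>M - 1\<close> and the upper one above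
  \<open>M\<close>. Comparison with \<open>M\<close> thus decides the copy, and subtracting
  \<open>M\<close> recovers the original vertex without existential quantifiers.\<close>

lemma lifted_edge_cases:
  fixes G :: graph and u v :: nat
  defines "M \<equiv> nverts G + 1"
  assumes "well_formed G"
  shows "{u, v} \<in> edges (lifted_graph G) \<longleftrightarrow>
    u \<noteq> v \<and> (u < M \<and> v < M \<and> {u, v} \<in> edges G \<or> M < u \<and> M < v \<and> {u - M, v - M} \<in> edges G) \<or>
    u = M \<and> (v < M \<and> has_loop G v \<or> M < v \<and> has_loop G (v - M)) \<or>
    v = M \<and> (u < M \<and> has_loop G u \<or> M < u \<and> has_loop G (u - M))"
  (is "_ = ?r")
proof -
  have e: "1 \<le> i" "i < M" "1 \<le> j" "j < M" if "{i, j} \<in> edges G" for i j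
    using well_formed_edge[OF assms(2) that] by (auto simp: verts_def M_def)
  have l: "1 \<le> i" "i < M" if "has_loop G i" for i
    using e[of i i] that by (auto simp: has_loop_def)
  have M: "i + nverts G + 1 = i + M" for i by (simp add: M_def)
  show ?thesis
    unfolding lifted_edge_iff M unfolding M_def[symmetric]
  proof
    assume ?r
    then consider "u \<noteq> v" "{u, v} \<in> edges G"
      | "u \<noteq> v" "M < u" "M < v" "{u - M, v - M} \<in> edges G"
      | "u = M" "has_loop G v" | "u = M" "M < v" "has_loop G (v - M)"
      | "v = M" "has_loop G u" | "v = M" "M < u" "has_loop G (u - M)"
      by blast
    then show "(\<exists>i j. i \<noteq> j \<and> {i, j} \<in> edges G \<and> (u = i \<and> v = j \<or> u = i + M \<and> v = j + M)) \<or>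
      (\<exists>i. has_loop G i \<and> (u = M \<and> (v = i \<or> v = i + M) \<or> v = M \<and> (u = i \<or> u = i + M)))"
    proof cases
      case 2
      then show ?thesis
        by (intro disjI1 exI[of _ "u - M"] exI[of _ "v - M"]) (simp add: eq_diff_iff)
    next
      case 4
      then show ?thesis by (intro disjI2 exI[of _ "v - M"]) simp
    next
      case 6
      then show ?thesis by (intro disjI2 exI[of _ "u - M"]) simp
    qed blast+
  next
    assume "(\<exists>i j. i \<noteq> j \<and> {i, j} \<in> edges G \<and> (u = i \<and> v = j \<or> u = i + M \<and> v = j + M)) \<or>
      (\<exists>i. has_loop G i \<and> (u = M \<and> (v = i \<or> v = i + M) \<or> v = M \<and> (u = i \<or> u = i + M)))"
    then consider i j where "i \<noteq> j" "{i, j} \<in> edges G" "u = i \<and> v = j \<or> u = i + M \<and> v = j + M"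
      | i where "has_loop G i" "u = M \<and> (v = i \<or> v = i + M) \<or> v = M \<and> (u = i \<or> u = i + M)"
      by blast
    then show ?r
    proof cases
      case 1
      from 1(3) show ?thesis by (elim disjE conjE) (use 1(1,2) e[OF 1(2)] in simp_all)
    next
      case 2
      from 2(2) show ?thesis by (elim disjE conjE) (use 2(1) l[OF 2(1)] in simp_all)
    qed
  qed
qed

text \<open>Puts the upper copy in the form used by \<open>lifted_edge_cases\<close>. Since 0 is not
  in \<open>A\<close>, the value \<open>n\<close> is not in the image, which justifies the strict
  \<open>n < v\<close>.\<close>

lemma shift_image:
  fixes n :: nat
  assumes "0 \<notin> A"
  shows "(\<lambda>j. j + n) ` A = {v. n < v \<and> v - n \<in> A}"
proof (intro equalityI subsetI)
  fix v assume "v \<in> {v. n < v \<and> v - n \<in> A}"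
  then show "v \<in> (\<lambda>j. j + n) ` A" by (intro image_eqI[of _ _ "v - n"]) simp_all
next
  fix v assume "v \<in> (\<lambda>j. j + n) ` A"
  then obtain j where "j \<in> A" "v = j + n" by blast
  moreover have "j \<noteq> 0" using assms \<open>j \<in> A\<close> by metis
  ultimately show "v \<in> {v. n < v \<and> v - n \<in> A}" by simp
qed

text \<open>Disjoint decompositions along which the sum in \<open>lap\<close> of the lifted graph
  splits. Comparing \<open>j\<close> with \<open>M\<close> selects the relevant branch of
  \<open>lifted_edge_cases\<close>.\<close>

lemma
  assumes "well_formed G"
  shows nbrs_lifted_lower: "a \<in> verts G \<Longrightarrow> nbrs (lifted_graph G) a =
      nbrs G a \<union> (if has_loop G a then {nverts G + 1} else {})" (is "_ \<Longrightarrow> ?lower")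
    and nbrs_lifted_upper: "a \<in> verts G \<Longrightarrow> nbrs (lifted_graph G) (a + (nverts G + 1)) =
      (\<lambda>j. j + (nverts G + 1)) ` nbrs G a \<union> (if has_loop G a then {nverts G + 1} else {})"
      (is "_ \<Longrightarrow> ?upper")
    and nbrs_lifted_middle: "nbrs (lifted_graph G) (nverts G + 1) =
      {i \<in> verts G. has_loop G i} \<union> (\<lambda>j. j + (nverts G + 1)) ` {i \<in> verts G. has_loop G i}"
      (is ?middle)
    and no_loop_lifted: "\<not> has_loop (lifted_graph G) b"
proof -
  define M where "M = nverts G + 1"
  have e: "1 \<le> i" "i < M" "1 \<le> j" "j < M" if "{i, j} \<in> edges G" for i j
    using well_formed_edge[OF assms that] by (auto simp: verts_def M_def)
  \<comment> \<open>The lifted graph has 2 N + 1 = 2 M - 1 vertices, hence the bound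
    \<open>2 * M\<close>.\<close>
  have v: "i \<in> verts G \<longleftrightarrow> 1 \<le> i \<and> i < M" "i \<in> verts (lifted_graph G) \<longleftrightarrow> 1 \<le> i \<and> i < 2 * M" for i
    by (auto simp: verts_def M_def)
  have n: "j \<in> nbrs G i \<longleftrightarrow> j \<noteq> i \<and> {i, j} \<in> edges G" for i j
    using e[of i j] unfolding nbrs_def v mem_Collect_eq by blast
  have ej: "{i, j} \<in> edges G \<longrightarrow> 1 \<le> j \<and> j < M" for i j
    using e[of i j] by blast
  have lj: "has_loop G j \<longrightarrow> 1 \<le> j \<and> j < M" for j
    using ej[of j j] by (simp add: has_loop_def)
  have shift: "(\<lambda>j. j + M) ` nbrs G i = {v. M < v \<and> v - M \<in> nbrs G i}"
    "(\<lambda>j. j + M) ` {i \<in> verts G. has_loop G i} = {v. M < v \<and> v - M \<in> {i \<in> verts G. has_loop G i}}" for i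
    by (rule shift_image, simp add: nbrs_def v)+
  have nl: "j \<in> nbrs (lifted_graph G) i \<longleftrightarrow> 1 \<le> j \<and> j < 2 * M \<and> j \<noteq> i \<and> {i, j} \<in> edges (lifted_graph G)" for i j
    by (auto simp: nbrs_def v)
  note lifted_edge = lifted_edge_cases[OF assms, folded M_def]
  show ?lower if "a \<in> verts G"
  proof (rule Set.set_eqI)
    fix j
    show "j \<in> nbrs (lifted_graph G) a \<longleftrightarrow>
        j \<in> nbrs G a \<union> (if has_loop G a then {nverts G + 1} else {})"
      using that ej[of a j] unfolding nl lifted_edge n v M_def[symmetric] Un_iff
      by (cases j M rule: linorder_cases) auto
  qed
  show ?upper if "a \<in> verts G"
  proof (rule Set.set_eqI)
    fix j
    show "j \<in> nbrs (lifted_graph G) (a + (nverts G + 1)) \<longleftrightarrow>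
        j \<in> (\<lambda>j. j + (nverts G + 1)) ` nbrs G a \<union> (if has_loop G a then {nverts G + 1} else {})"
      using that ej[of a "j - M"]
      unfolding M_def[symmetric] shift nl lifted_edge n v Un_iff mem_Collect_eq
      by (cases j M rule: linorder_cases) auto
  qed
  show ?middle
  proof (rule Set.set_eqI)
    fix j
    show "j \<in> nbrs (lifted_graph G) (nverts G + 1) \<longleftrightarrow>
        j \<in> {i \<in> verts G. has_loop G i} \<union> (\<lambda>j. j + (nverts G + 1)) ` {i \<in> verts G. has_loop G i}"
      using lj[of j] lj[of "j - M"]
      unfolding M_def[symmetric] shift unfolding nl lifted_edge v Un_iff mem_Collect_eq
      by (cases j M rule: linorder_cases) auto
  qed
  show "\<not> has_loop (lifted_graph G) b"
    unfolding has_loop_def[of "lifted_graph G"] lifted_edge by auto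
qed

section \<open>Antisymmetric extension of eigenfunctions to the lifted graph\<close>

definition lift_fun :: "nat \<Rightarrow> (nat \<Rightarrow> complex) \<Rightarrow> nat \<Rightarrow> complex" where
  "lift_fun n f v = (if v \<le> n then f v else if v = n + 1 then 0 else - f (v - (n + 1)))"

lemma lap_lift_fun:
  assumes "well_formed G" "\<forall>a\<in>verts G. lap G f a = k * f a" "v \<in> verts (lifted_graph G)"
  shows "lap (lifted_graph G) (lift_fun (nverts G) f) v = k * lift_fun (nverts G) f v"
proof -
  let ?N = "nverts G" and ?h = "lift_fun (nverts G) f"
  have low: "?h a = f a" and up: "?h (a + (?N + 1)) = - f a" if "a \<in> verts G" for a
    using that by (auto simp: lift_fun_def verts_def)
  have mid: "?h (?N + 1) = 0" by (simp add: lift_fun_def)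
  have nv: "j \<in> verts G" if "j \<in> nbrs G a" for a j using that by (simp add: nbrs_def)
  from assms(3) consider "v \<in> verts G" | "v = ?N + 1" | a where "a \<in> verts G" "v = a + (?N + 1)"
  proof -
    assume *: "v \<in> verts G \<Longrightarrow> thesis" "v = ?N + 1 \<Longrightarrow> thesis"
      "\<And>a. a \<in> verts G \<Longrightarrow> v = a + (?N + 1) \<Longrightarrow> thesis"
    show thesis
      using *(1,2) *(3)[of "v - (?N + 1)"] assms(3) by (force simp: verts_def)
  qed
  then show ?thesis
  proof cases
    case 1
    \<comment> \<open>The edge to the middle vertex contributes \<open>f v - 0\<close>, exactly the
      self-loop term of \<open>lap G f v\<close>.\<close>
    have "(\<Sum>j\<in>nbrs (lifted_graph G) v. ?h v - ?h j) =
        (\<Sum>j\<in>nbrs G v. ?h v - ?h j) + (if has_loop G v then ?h v - ?h (?N + 1) else 0)"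
      unfolding nbrs_lifted_lower[OF assms(1) 1]
      by (subst sum.union_disjoint) (auto simp: nbrs_def verts_def)
    also have "\<dots> = lap G f v"
      unfolding lap_def mid by (auto simp: low[OF 1] low[OF nv] cong: sum.cong)
    finally show ?thesis
      using assms(2) 1 by (simp add: lap_def[of "lifted_graph G"] no_loop_lifted[OF assms(1)] low)
  next
    case 2
    \<comment> \<open>The two copies of each looped vertex are joined to the middle and carry
      opposite values, so their terms cancel.\<close>
    have "(\<Sum>j\<in>nbrs (lifted_graph G) v. ?h v - ?h j) =
        (\<Sum>j\<in>{i \<in> verts G. has_loop G i}. - ?h j) +
        (\<Sum>j\<in>{i \<in> verts G. has_loop G i}. - ?h (j + (?N + 1)))"
      unfolding 2 nbrs_lifted_middle[OF assms(1)] mid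
      by (subst sum.union_disjoint) (auto simp: verts_def sum.reindex inj_on_def)
    also have "\<dots> = 0"
      unfolding sum.distrib[symmetric] 
      by (intro sum.neutral ballI, drule CollectD, elim conjE, simp only: low up, simp)
    finally show ?thesis
      using mid 2 by (simp add: lap_def[of "lifted_graph G"] no_loop_lifted[OF assms(1)])
  next
    case (3 a)
    \<comment> \<open>On the upper copy all values are negated, so by linearity the lower
      computation recurs with a minus sign.\<close>
    have "(\<Sum>j\<in>nbrs (lifted_graph G) v. ?h v - ?h j) =
        (\<Sum>j\<in>nbrs G a. ?h v - ?h (j + (?N + 1))) + (if has_loop G a then ?h v - ?h (?N + 1) else 0)"
      unfolding 3(2) nbrs_lifted_upper[OF assms(1) 3(1)]
      by (subst sum.union_disjoint) (auto simp: nbrs_def verts_def sum.reindex inj_on_def)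
    also have "\<dots> = - lap G f a"
      unfolding lap_def mid 3(2) up[OF 3(1)] sum_negf[symmetric] minus_add_distrib
      by (intro arg_cong2[where f = "(+)"] sum.cong) (auto simp: up[OF nv, simplified])
    finally show ?thesis
      using assms(2) 3 up[OF 3(1)]
      by (simp add: lap_def[of "lifted_graph G"] no_loop_lifted[OF assms(1)])
  qed
qed

lemma eigvals_subset_lifted:
  assumes "well_formed G"
  shows "eigvals (laplacian G) \<subseteq> eigvals (laplacian (lifted_graph G))"
proof
  fix k assume "k \<in> eigvals (laplacian G)"
  then obtain f a where f: "a \<in> verts G" "f a \<noteq> 0" "\<forall>a\<in>verts G. lap G f a = k * f a"
    unfolding eigvals_laplacian_iff by blast
  \<comment> \<open>The extension agrees with \<open>f\<close> on the lower copy, so the same vertex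
    shows that it is nonzero.\<close>
  have "a \<in> verts (lifted_graph G)" "lift_fun (nverts G) f a \<noteq> 0"
    using f(1,2) by (auto simp: verts_def lift_fun_def)
  then show "k \<in> eigvals (laplacian (lifted_graph G))"
    unfolding eigvals_laplacian_iff using lap_lift_fun[OF assms f(3)] by blast
qed

theorem theorem1:
  fixes G :: graph
  assumes "well_formed G"
    and "\<exists>i \<in> verts G. has_loop G i"
  shows "eigvals (laplacian G)
           \<subseteq> eigvals (laplacian (lifted_graph G))
              \<inter> complex_of_real ` {0..2 * real (max_degree (del_loops G)) + 1} \<and>
         (pseudo_connected G \<longrightarrow>
           eigvals (laplacian G)
             \<subseteq> pos_eigvals (laplacian (lifted_graph G))
                \<inter> complex_of_real ` {0..2 * real (max_degree (del_loops G)) + 1})"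
proof -
  let ?d = "2 * real (max_degree (del_loops G)) + 1"
  have "k \<in> complex_of_real ` {0..?d} \<and> (pseudo_connected G \<longrightarrow> k \<in> complex_of_real ` {0<..})"
    if "k \<in> eigvals (laplacian G)" for k
  proof -
    from that obtain f where f: "\<exists>a\<in>verts G. f a \<noteq> 0" "\<forall>a\<in>verts G. lap G f a = k * f a"
      unfolding eigvals_laplacian_iff by (elim exE conjE)
    show ?thesis
      by (rule lap_eigenvalue_bounds[OF assms(1) f]) simp
  qed
  \<comment> \<open>Reality, bounds and positivity were proved for \<open>k\<close> as an eigenvalue
    of \<open>G\<close>; only membership in the larger spectrum involves the lifted graph.\<close>
  then show ?thesis
    using eigvals_subset_lifted[OF assms(1)] unfolding pos_eigvals_def
    by (intro conjI impI subsetI IntI) (simp_all only: subset_iff)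
qed

end
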